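(* Let $m\ge1$ and $\kappa_m=\sqrt{\ln(4m)/\pi}$. The average number of edges of the minimal dag of an $m$-labeled binary tree of size $n$, taken uniformly at random, satisfies $$\bar E^{\mathcal B}_{m,n}=3\kappa_m\frac{n}{\sqrt{\ln n}}\left(1+O\!\left(\frac1{\ln n}\right)\right)\quad(n\to\infty).$$
   Context: An $m$-labeled binary tree is a non-empty finite rooted tree with node labels in $\{1,\dots,m\}$ in which every node has an optional left and an optional right child (distinguished); its size is its number of edges. Its minimal dag has one node per distinct subtree (subtree = a node with all its descendants) and, from the node of each distinct subtree, one edge to the node of each of its non-empty left/right subtrees; so its number of edges is the sum over distinct subtrees of the number of children of their root. $\bar E^{\mathcal B}_{m,n}$ is the average of this number over all $m$-labeled binary trees of size $n$. *)

theory Defs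
  imports "HOL-Library.Tree" "HOL-Library.Landau_Symbols" Complex_Main
begin

text \<open>An m-labeled binary tree is a non-empty tree (not Leaf) of the Tree library whose
  node labels lie in {1..m}; Leaf encodes an absent child. Its size is its number of
  edges, i.e. number of nodes minus one.\<close>

definition labeled_trees :: "nat \<Rightarrow> nat \<Rightarrow> nat tree set" where
  "labeled_trees m n = {t. t \<noteq> Leaf \<and> set_tree t \<subseteq> {1..m} \<and> size t = n + 1}"

fun root_children :: "'a tree \<Rightarrow> nat" where
  "root_children Leaf = 0"
| "root_children (Node l a r) = (if l \<noteq> Leaf then 1 else 0) + (if r \<noteq> Leaf then 1 else 0)"

definition dag_edges :: "'a tree \<Rightarrow> nat" where
  "dag_edges t = (\<Sum>s \<in> subtrees t - {Leaf}. root_children s)"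

definition avg_dag_edges :: "nat \<Rightarrow> nat \<Rightarrow> real" where
  "avg_dag_edges m n =
     real (\<Sum>t \<in> labeled_trees m n. dag_edges t) / real (card (labeled_trees m n))"

definition kappa :: "nat \<Rightarrow> real" where
  "kappa m = sqrt (ln (4 * real m) / pi)"

end

theory Submission
  imports Defs "HOL-Analysis.Gamma_Function" "HOL-Computational_Algebra.Formal_Power_Series"
    "HOL-Real_Asymp.Real_Asymp"
begin

text \<open>
  Fix a tree \<open>s\<close> with \<open>k\<close> nodes. Summed over all trees with \<open>N\<close> nodes, the number of occurrences
  of \<open>s\<close> and the number of ordered pairs of distinct occurrences have the generating functions
  \<open>X ^ k (1 - 4 m X) powr (-1/2)\<close> and \<open>2 m X ^ (2 k + 1) (1 - 4 m X) powr (-3/2)\<close>.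
  Cut the sum over \<open>s\<close> at \<open>K = \<lfloor>log (4 m) n\<rfloor>\<close>. There are so few trees with at most \<open>K\<close> nodes that
  they contribute only \<open>O(n / K powr (3/2))\<close>, and by the Bonferroni inequality the repeated
  occurrences of larger trees are of the same order. What remains is the expected number of edges
  below fringe subtrees with more than \<open>K\<close> nodes. It is obtained from a telescoping
  sum as \<open>3 n (2 K choose K) / 4 ^ K\<close> up to the same error, and Wallis' product turns this into
  \<open>3 n / sqrt (pi K)\<close>.
\<close>

unbundle fps_syntax

section \<open>Normalised central binomial coefficients\<close>

text \<open>This is \<open>(2n choose n) / 4^n\<close>.\<close>

definition cbin :: "nat \<Rightarrow> real" where
  "cbin n = (-1) ^ n * ((- (1/2)) gchoose n)"

lemma cbin_0 [simp]: "cbin 0 = 1"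
  by (simp add: cbin_def)

lemma gbinomial_Suc_ratio:
  fixes a :: real
  shows "a gchoose Suc n = (a gchoose n) * (a - real n) / (real n + 1)"
  using gbinomial_mult_1[of a n] by (simp add: field_simps)

lemma cbin_Suc: "cbin (Suc n) = cbin n * (2 * real n + 1) / (2 * real n + 2)"
  by (simp add: cbin_def gbinomial_Suc_ratio field_simps)

lemma cbin_pos: "cbin n > 0"
  by (induction n) (simp_all add: cbin_Suc)

lemma cbin_Suc_le: "cbin (Suc n) \<le> cbin n"
  using cbin_pos[of n] by (simp add: cbin_Suc field_simps)

lemma decseq_cbin: "decseq cbin"
  by (simp add: decseq_Suc_iff cbin_Suc_le)

text \<open>The recurrence gives \<open>(n + 1) * cbin (n + 1) = (n + 1/2) * cbin n\<close>. This
  monotonicity later bounds \<open>cbin (N - k) / cbin N\<close> by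
  \<open>N / (N - k)\<close>.\<close>

lemma mult_cbin_mono:
  assumes "i \<le> j"
  shows "real i * cbin i \<le> real j * cbin j"
proof -
  have "real n * cbin n \<le> real (Suc n) * cbin (Suc n)" for n
  proof -
    have "real n * cbin n \<le> (real n + 1/2) * cbin n"
      using cbin_pos[of n] by (intro mult_right_mono) auto
    also have "\<dots> = real (Suc n) * cbin (Suc n)"
      by (simp add: cbin_Suc field_simps)
    finally show ?thesis .
  qed
  from lift_Suc_mono_le[of "\<lambda>n. real n * cbin n", OF this assms] show ?thesis .
qed

text \<open>Consecutive terms have ratio \<open>(2 n + 3) / (2 n + 2)\<close>. Up to a power of
  \<open>4 * M\<close> they are the coefficients of \<open>lin_pow M (- (3/2))\<close>, which govern
  pairs of occurrences.\<close>

lemma odd_mult_cbin_mono: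
  assumes "i \<le> j"
  shows "(2 * real i + 1) * cbin i \<le> (2 * real j + 1) * cbin j"
proof -
  have "(2 * real n + 1) * cbin n \<le> (2 * real (Suc n) + 1) * cbin (Suc n)" for n
    using cbin_pos[of n] by (simp add: cbin_Suc field_simps)
  from lift_Suc_mono_le[of "\<lambda>n. (2 * real n + 1) * cbin n", OF this assms] show ?thesis .
qed

text \<open>The factor with index \<open>n + 1\<close> is
  \<open>(2 n + 2)^2 / ((2 n + 1) (2 n + 3))\<close>, which the recurrence of \<open>cbin\<close>
  reproduces. It makes the Wallis limit available for \<open>cbin\<close>.\<close>

lemma wallis_prod_eq:
  "(\<Prod>k=1..n. (4 * real k ^ 2) / (4 * real k ^ 2 - 1)) = 1 / ((cbin n)\<^sup>2 * (2 * real n + 1))"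
proof (induction n)
  case (Suc n)
  have *: "4 * real (Suc n) ^ 2 - 1 = (2 * real n + 1) * (2 * real n + 3)"
    by (simp add: power2_eq_square algebra_simps)
  have "(\<Prod>k=1..Suc n. (4 * real k ^ 2) / (4 * real k ^ 2 - 1))
      = 1 / ((cbin n)\<^sup>2 * (2 * real n + 1)) * (4 * real (Suc n) ^ 2 / ((2 * real n + 1) * (2 * real n + 3)))"
    using Suc by (simp only: prod.nat_ivl_Suc' * mult.commute)
  also have "\<dots> = 1 / ((cbin (Suc n))\<^sup>2 * (2 * real (Suc n) + 1))"
    using cbin_pos[of n] by (simp add: cbin_Suc divide_simps) (simp add: power2_eq_square, simp add: algebra_simps)
  finally show ?case .
qed simp

lemma cbin_sq_tendsto: "(\<lambda>n. (cbin n)\<^sup>2 * (2 * real n + 1)) \<longlonglongrightarrow> 2 / pi"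
proof -
  have "(\<lambda>n. inverse (\<Prod>k=1..n. (4 * real k ^ 2) / (4 * real k ^ 2 - 1))) \<longlonglongrightarrow> inverse (pi / 2)"
    by (intro tendsto_inverse wallis) simp
  then show ?thesis
    unfolding wallis_prod_eq by (simp add: field_simps)
qed

text \<open>Since \<open>(2 n + 1) (2 n + 3)\<close> is at most \<open>(2 n + 2)^2\<close>, the
  sequence \<open>cbin n ^ 2 * (2 n + 1)\<close> decreases and so stays above its limit
  \<open>2 / pi\<close>.\<close>

lemma cbin_lower: "1 / sqrt (pi * (real n + 1 / 2)) \<le> cbin n"
proof -
  have "decseq (\<lambda>n. (cbin n)\<^sup>2 * (2 * real n + 1))"
    unfolding decseq_Suc_iff
  proof
    fix n
    have "(cbin (Suc n))\<^sup>2 * (2 * real (Suc n) + 1)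
            = ((cbin n)\<^sup>2 * (2 * real n + 1)) * ((2 * real n + 1) * (2 * real n + 3) / (2 * real n + 2)\<^sup>2)"
      by (simp add: cbin_Suc power2_eq_square field_simps)
    also have "\<dots> \<le> ((cbin n)\<^sup>2 * (2 * real n + 1)) * 1"
    proof (rule mult_left_mono)
      have "(2 * real n + 1) * (2 * real n + 3) \<le> (2 * real n + 2)\<^sup>2"
        by (simp add: power2_eq_square algebra_simps)
      then show "(2 * real n + 1) * (2 * real n + 3) / (2 * real n + 2)\<^sup>2 \<le> 1"
        by (simp add: divide_le_eq)
    qed simp
    finally show "(cbin (Suc n))\<^sup>2 * (2 * real (Suc n) + 1) \<le> (cbin n)\<^sup>2 * (2 * real n + 1)"
      by simp
  qed
  from decseq_ge[OF this cbin_sq_tendsto] have "2 / pi \<le> (cbin n)\<^sup>2 * (2 * real n + 1)" .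
  then have "1 / (pi * (real n + 1/2)) \<le> (cbin n)\<^sup>2"
    by (simp add: divide_le_eq add_pos_nonneg) (simp add: algebra_simps)
  then have "sqrt (1 / (pi * (real n + 1/2))) \<le> sqrt ((cbin n)\<^sup>2)"
    by (rule real_sqrt_le_mono)
  then show ?thesis
    using cbin_pos[of n] by (simp add: real_sqrt_divide)
qed

text \<open>With \<open>2 n\<close> in place of \<open>2 n + 1\<close> the sequence increases to the
  same limit \<open>2 / pi\<close>.\<close>

lemma cbin_upper:
  assumes "n > 0"
  shows "cbin n \<le> 1 / sqrt (pi * real n)"
proof -
  have inc: "incseq (\<lambda>n. (cbin n)\<^sup>2 * (2 * real n))"
    unfolding incseq_Suc_iff
  proof
    fix n
    have "(cbin n)\<^sup>2 * (2 * real n) \<le> (cbin n)\<^sup>2 * ((2 * real n + 1)\<^sup>2 / (2 * real n + 2))"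
    proof (rule mult_left_mono)
      have "2 * real n * (2 * real n + 2) \<le> (2 * real n + 1)\<^sup>2"
        by (simp add: power2_eq_square algebra_simps)
      then show "2 * real n \<le> (2 * real n + 1)\<^sup>2 / (2 * real n + 2)"
        by (simp add: pos_le_divide_eq)
    qed simp
    also have "\<dots> = (cbin (Suc n))\<^sup>2 * (2 * real (Suc n))"
      by (simp add: cbin_Suc power2_eq_square divide_simps)
    finally show "(cbin n)\<^sup>2 * (2 * real n) \<le> (cbin (Suc n))\<^sup>2 * (2 * real (Suc n))" .
  qed
  have "(\<lambda>n. (cbin n)\<^sup>2 * (2 * real n + 1) * (2 * real n / (2 * real n + 1))) \<longlonglongrightarrow> 2 / pi * 1"
  proof (intro tendsto_mult cbin_sq_tendsto)
    have "(\<lambda>n. 1 - 1 / real (Suc (2 * n))) \<longlonglongrightarrow> 1 - 0"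
      by (intro tendsto_intros LIMSEQ_subseq_LIMSEQ[OF LIMSEQ_Suc[OF lim_1_over_n], of "\<lambda>n. 2 * n", unfolded o_def])
         (simp add: strict_mono_def)
    then show "(\<lambda>n. 2 * real n / (2 * real n + 1)) \<longlonglongrightarrow> 1"
      by (simp add: field_simps)
  qed
  moreover have "(cbin n)\<^sup>2 * (2 * real n + 1) * (2 * real n / (2 * real n + 1)) = (cbin n)\<^sup>2 * (2 * real n)" for n
    by simp
  ultimately have "(\<lambda>n. (cbin n)\<^sup>2 * (2 * real n)) \<longlonglongrightarrow> 2 / pi" by simp
  from incseq_le[OF inc this] have "(cbin n)\<^sup>2 * (2 * real n) \<le> 2 / pi" .
  then have "(cbin n)\<^sup>2 \<le> 1 / (pi * real n)"
    using assms by (simp add: field_simps)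
  then have "sqrt ((cbin n)\<^sup>2) \<le> sqrt (1 / (pi * real n))"
    by (rule real_sqrt_le_mono)
  then show ?thesis
    using cbin_pos[of n] by (simp add: real_sqrt_divide)
qed

section \<open>Powers of a linear power series\<close>

text \<open>The power series \<open>(1 - 4 M X)\<close> raised to the power \<open>a\<close>.\<close>

definition lin_pow :: "real \<Rightarrow> real \<Rightarrow> real fps" where
  "lin_pow M a = Abs_fps (\<lambda>n. (- 4 * M) ^ n * (a gchoose n))"

lemma lin_pow_mult: "lin_pow M a * lin_pow M b = lin_pow M (a + b)"
proof (rule fps_ext)
  fix n
  have "(lin_pow M a * lin_pow M b) $ n
      = (\<Sum>i=0..n. (- 4 * M) ^ n * ((a gchoose i) * (b gchoose (n - i))))"
    unfolding fps_mult_nth lin_pow_def fps_nth_Abs_fps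
  proof (intro sum.cong refl)
    fix i assume "i \<in> {0..n}"
    then have "(- 4 * M) ^ n = (- 4 * M) ^ i * (- 4 * M) ^ (n - i)"
      by (simp flip: power_add)
    then show "(- 4 * M) ^ i * (a gchoose i) * ((- 4 * M) ^ (n - i) * (b gchoose (n - i)))
        = (- 4 * M) ^ n * ((a gchoose i) * (b gchoose (n - i)))"
      by simp
  qed
  also have "\<dots> = lin_pow M (a + b) $ n"
    by (simp add: lin_pow_def gbinomial_Vandermonde flip: sum_distrib_left)
  finally show "(lin_pow M a * lin_pow M b) $ n = lin_pow M (a + b) $ n" .
qed

lemma lin_pow_0: "lin_pow M 0 = 1"
  by (rule fps_ext) (auto simp: lin_pow_def gbinomial_0_left)

lemma lin_pow_1: "lin_pow M 1 = 1 - fps_const (4 * M) * fps_X"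
proof (rule fps_ext)
  fix n
  have "(1::real) gchoose n = (if n \<le> 1 then 1 else 0)"
    using binomial_gbinomial[of 1 n, where 'a = real] by (cases n) (auto simp: binomial_eq_0)
  then show "lin_pow M 1 $ n = (1 - fps_const (4 * M) * fps_X) $ n"
    by (cases n) (auto simp: lin_pow_def fps_X_def)
qed

lemma lin_pow_minus_half_nth: "lin_pow M (- (1/2)) $ n = (4 * M) ^ n * cbin n"
  by (simp add: lin_pow_def cbin_def power_minus[of "4 * M"])

lemma lin_pow_minus_three_halves_nth:
  "lin_pow M (- (3/2)) $ n = (4 * M) ^ n * ((2 * real n + 1) * cbin n)"
proof -
  have "(-1) ^ n * ((- (3/2)) gchoose n) = (2 * real n + 1) * cbin n"
  proof (induction n)
    case (Suc n)
    have "(-1) ^ Suc n * ((- (3/2)) gchoose Suc n)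
        = ((-1) ^ n * ((- (3/2)) gchoose n)) * (2 * real n + 3) / (2 * real n + 2)"
      by (simp add: gbinomial_Suc_ratio field_simps)
    also have "\<dots> = (2 * real (Suc n) + 1) * cbin (Suc n)"
      unfolding Suc by (simp add: cbin_Suc field_simps)
    finally show ?case .
  qed simp
  then show ?thesis
    by (simp add: lin_pow_def power_minus[of "4 * M"] mult.assoc)
qed

lemma lin_pow_minus_one_half_nth_Suc:
  "lin_pow M (1/2) $ Suc n = - 2 * M * ((4 * M) ^ n * cbin n / (real n + 1))"
proof -
  have *: "((1/2) gchoose Suc n) = (1/2) * ((- (1/2)) gchoose n) / (real n + 1)"
    using gbinomial_absorption[of n "1/2::real"] by (simp add: field_simps)
  show ?thesis
    by (simp add: lin_pow_def cbin_def * power_minus[of "4 * M"] power_mult_distrib)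
       (simp add: field_simps)
qed

section \<open>Trees and occurrences of a fixed subtree\<close>

definition trees :: "nat \<Rightarrow> nat \<Rightarrow> nat tree set" where
  "trees m n = {t. set_tree t \<subseteq> {1..m} \<and> size t = n}"

lemma trees_0 [simp]: "trees m 0 = {Leaf}"
  by (auto simp: trees_def)

lemma labeled_trees_eq: "labeled_trees m n = trees m (Suc n)"
  by (auto simp: labeled_trees_def trees_def)

lemma trees_Suc:
  "trees m (Suc n) = (\<lambda>(i, a, l, r). Node l a r) `
     (SIGMA i:{..n}. {1..m} \<times> trees m i \<times> trees m (n - i))" (is "?A = ?B")
proof
  show "?A \<subseteq> ?B"
  proof
    fix t assume t: "t \<in> ?A"
    then obtain l a r where [simp]: "t = Node l a r"
      by (cases t) (auto simp: trees_def)
    show "t \<in> ?B"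
      using t by (intro image_eqI[of _ _ "(size l, a, l, r)"]) (auto simp: trees_def)
  qed
qed (force simp: trees_def)

lemma finite_trees [simp]: "finite (trees m n)"
proof (induction n rule: less_induct)
  case (less n)
  show ?case
  proof (cases n)
    case (Suc k)
    show ?thesis unfolding Suc trees_Suc
      using less Suc by (intro finite_imageI finite_SigmaI finite_cartesian_product) auto
  qed simp
qed

lemma sum_trees_Suc:
  fixes f :: "nat tree \<Rightarrow> 'a :: comm_monoid_add"
  shows "(\<Sum>t\<in>trees m (Suc n). f t)
    = (\<Sum>i\<le>n. \<Sum>a\<in>{1..m}. \<Sum>l\<in>trees m i. \<Sum>r\<in>trees m (n - i). f (Node l a r))"
proof -
  have "inj_on (\<lambda>(i, a, l, r). Node l a r) (SIGMA i:{..n}. {1..m} \<times> trees m i \<times> trees m (n - i))"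
    by (auto simp: inj_on_def trees_def)
  then show ?thesis
    unfolding trees_Suc
    by (subst sum.reindex) (auto simp: sum.Sigma sum.cartesian_product o_def case_prod_unfold)
qed

section \<open>Generating functions by number of nodes\<close>

definition tree_gf :: "nat \<Rightarrow> (nat tree \<Rightarrow> real) \<Rightarrow> real fps" where
  "tree_gf m f = Abs_fps (\<lambda>n. \<Sum>t\<in>trees m n. f t)"

lemma tree_gf_nth: "tree_gf m f $ n = (\<Sum>t\<in>trees m n. f t)"
  by (simp add: tree_gf_def)

lemma tree_gf_add: "tree_gf m (\<lambda>t. f t + g t) = tree_gf m f + tree_gf m g"
  by (rule fps_ext) (simp add: tree_gf_nth sum.distrib)

lemma tree_gf_cmult: "tree_gf m (\<lambda>t. c * f t) = fps_const c * tree_gf m f"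
  by (rule fps_ext) (simp add: tree_gf_nth sum_distrib_left)

text \<open>The root label contributes the factor \<open>m\<close>, the root node a factor
  \<open>X\<close>, and the independent choice of the two children a Cauchy product.\<close>

lemma tree_gf_node:
  "tree_gf m (case_tree 0 (\<lambda>l a r. f l * g r))
     = fps_const (real m) * fps_X * tree_gf m f * tree_gf m g"
proof (rule fps_ext)
  fix n
  show "tree_gf m (case_tree 0 (\<lambda>l a r. f l * g r)) $ n
      = (fps_const (real m) * fps_X * tree_gf m f * tree_gf m g) $ n"
  proof (cases n)
    case (Suc k)
    have "tree_gf m (case_tree 0 (\<lambda>l a r. f l * g r)) $ Suc k
        = (\<Sum>i\<le>k. real m * (tree_gf m f $ i * tree_gf m g $ (k - i)))"
      by (simp add: tree_gf_nth sum_trees_Suc sum_product)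
    also have "\<dots> = real m * (tree_gf m f * tree_gf m g) $ k"
      by (simp add: fps_mult_nth sum_distrib_left atLeast0AtMost)
    finally show ?thesis
      by (simp add: Suc mult.assoc)
  qed (simp add: tree_gf_nth mult.assoc)
qed

abbreviation num_trees :: "nat \<Rightarrow> nat \<Rightarrow> real" where
  "num_trees m n \<equiv> real (card (trees m n))"

lemma tree_gf_leaf: "tree_gf m (\<lambda>t. of_bool (t = Leaf)) = 1"
proof (rule fps_ext)
  fix n show "tree_gf m (\<lambda>t. of_bool (t = Leaf)) $ n = 1 $ n"
    by (cases n) (auto simp: tree_gf_nth trees_Suc intro!: sum.neutral)
qed

lemma tree_gf_1_eq:
  "tree_gf m (\<lambda>_. 1) = 1 + fps_const (real m) * fps_X * tree_gf m (\<lambda>_. 1) * tree_gf m (\<lambda>_. 1)"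
proof -
  have "(\<lambda>_::nat tree. 1::real) = (\<lambda>t. of_bool (t = Leaf) + case_tree 0 (\<lambda>l a r. 1 * 1) t)"
    by (auto split: tree.split)
  then have "tree_gf m (\<lambda>_. 1) = tree_gf m (\<lambda>t. of_bool (t = Leaf) + case_tree 0 (\<lambda>l a r. 1 * 1) t)"
    by simp
  then show ?thesis
    unfolding tree_gf_add tree_gf_leaf tree_gf_node .
qed

text \<open>Completing the square in the quadratic equation \<open>tree_gf_1_eq\<close> shows that
  both sides are square roots of \<open>1 - 4 m X\<close>.\<close>

lemma tree_gf_1: "1 - fps_const (2 * real m) * fps_X * tree_gf m (\<lambda>_. 1) = lin_pow (real m) (1/2)"
  (is "?P = ?Q")
proof -
  define A where "A = tree_gf m (\<lambda>_. 1)"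
  define Z where "Z = fps_const (real m) * fps_X"
  have A: "A = 1 + Z * A * A"
    unfolding A_def Z_def by (rule tree_gf_1_eq)
  have c: "fps_const (2 * real m) * fps_X = 2 * Z" "fps_const (4 * real m) * fps_X = 4 * Z"
    by (simp_all add: Z_def fps_numeral_fps_const mult.assoc flip: fps_const_mult)
  have "?Q * ?Q = 1 - 4 * Z"
    by (simp add: lin_pow_mult lin_pow_1 c(2))
  moreover have "?P * ?P = 1 - 4 * Z"
  proof -
    have "?P * ?P = 1 - 4 * Z * A + 4 * Z * (Z * A * A)"
      unfolding c A_def[symmetric] by (simp add: algebra_simps)
    also have "Z * A * A = A - 1" using A by (simp add: algebra_simps)
    finally show ?thesis by (simp add: algebra_simps)
  qed
  ultimately have "(?P + ?Q) * (?P - ?Q) = 0"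
    unfolding square_diff_square_factored[symmetric] by simp
  \<comment> \<open>The constant coefficient fixes the sign of the square root by excluding
    \<open>?P = - ?Q\<close>.\<close>
  moreover have "(?P + ?Q) $ 0 = 2"
    by (simp add: lin_pow_def mult.assoc)
  then have "?P + ?Q \<noteq> 0" by (metis fps_zero_nth zero_neq_numeral)
  ultimately show ?thesis by simp
qed

text \<open>This is \<open>m ^ n\<close> times the Catalan number, read off from
  \<open>tree_gf_1\<close> at exponent \<open>n + 1\<close>.\<close>

lemma num_trees_eq:
  assumes "m \<ge> 1"
  shows "num_trees m n = (4 * real m) ^ n * cbin n / (real n + 1)"
proof -
  have "(1 - fps_const (2 * real m) * fps_X * tree_gf m (\<lambda>_. 1)) $ Suc n = - 2 * real m * num_trees m n"
    by (simp add: mult.assoc tree_gf_nth)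
  then have "- 2 * real m * num_trees m n = - 2 * real m * ((4 * real m) ^ n * cbin n / (real n + 1))"
    unfolding tree_gf_1 lin_pow_minus_one_half_nth_Suc by simp
  then show ?thesis using assms by (simp only: mult_cancel_left) auto
qed

section \<open>Occurrences of a fixed subtree, with multiplicity\<close>

fun occ :: "'a tree \<Rightarrow> 'a tree \<Rightarrow> nat" where
  "occ s Leaf = of_bool (s = Leaf)"
| "occ s (Node l a r) = of_bool (s = Node l a r) + occ s l + occ s r"

lemma occ_pos_iff: "occ s t > 0 \<longleftrightarrow> s \<in> subtrees t"
  by (induction t) auto

lemma occ_eq_0: "size t < size s \<Longrightarrow> occ s t = 0"
  using size_subtrees[of s t] occ_pos_iff[of s t] by fastforce

lemma tree_gf_single:
  assumes "s \<in> trees m k"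
  shows "tree_gf m (\<lambda>t. of_bool (t = s)) = fps_X ^ k"
proof (rule fps_ext)
  fix n
  show "tree_gf m (\<lambda>t. of_bool (t = s)) $ n = (fps_X ^ k) $ n"
  proof (cases "n = k")
    case True
    then show ?thesis
      using assms by (simp add: tree_gf_nth)
  next
    case False
    then have "s \<notin> trees m n" using assms by (auto simp: trees_def)
    then show ?thesis using False
      by (auto simp: tree_gf_nth intro!: sum.neutral)
  qed
qed

text \<open>A statistic that is additive over the two children up to a term \<open>H\<close>
  satisfies this equation. Collecting \<open>F\<close> leaves the factor \<open>1 - 2 m X A\<close>
  with \<open>A = tree_gf m (\<lambda>_. 1)\<close>, a square root by \<open>tree_gf_1\<close>,
  which is then inverted.\<close>

lemma tree_gf_linear_solve:
  assumes "F = H + fps_const (2 * real m) * fps_X * tree_gf m (\<lambda>_. 1) * F"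
  shows "F = H * lin_pow (real m) (- (1/2))"
proof -
  have "F * lin_pow (real m) (1/2) = H"
    unfolding tree_gf_1[symmetric] using assms by (simp add: algebra_simps)
  then have "F * (lin_pow (real m) (1/2) * lin_pow (real m) (- (1/2))) = H * lin_pow (real m) (- (1/2))"
    by (metis mult.assoc)
  then show ?thesis by (simp add: lin_pow_mult lin_pow_0)
qed

lemma fps_const_double: "fps_const (2 * real m) = fps_const (real m) + fps_const (real m)"
  by (simp add: fps_const_add)

text \<open>An occurrence of \<open>s\<close> is the whole tree or lies in one of the two
  children.\<close>

lemma tree_gf_occ:
  assumes s: "s \<in> trees m k" and k: "k > 0"
  shows "tree_gf m (\<lambda>t. real (occ s t)) = fps_X ^ k * lin_pow (real m) (- (1/2))"
proof (rule tree_gf_linear_solve)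
  have "s \<noteq> Leaf" using s k by (auto simp: trees_def)
  \<comment> \<open>The factors 1 give each summand the product shape required by
    \<open>tree_gf_node\<close>.\<close>
  then have "real (occ s t) = of_bool (t = s)
     + (case_tree 0 (\<lambda>l a r. real (occ s l) * 1) t + case_tree 0 (\<lambda>l a r. 1 * real (occ s r)) t)" for t
    by (cases t) auto
  then have "tree_gf m (\<lambda>t. real (occ s t)) = tree_gf m (\<lambda>t. of_bool (t = s)
     + (case_tree 0 (\<lambda>l a r. real (occ s l) * 1) t + case_tree 0 (\<lambda>l a r. 1 * real (occ s r)) t))"
    by (intro arg_cong[of _ _ "tree_gf m"] ext)
  then show "tree_gf m (\<lambda>t. real (occ s t)) = fps_X ^ k
     + fps_const (2 * real m) * fps_X * tree_gf m (\<lambda>_. 1) * tree_gf m (\<lambda>t. real (occ s t))"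
    unfolding tree_gf_add tree_gf_single[OF s] tree_gf_node fps_const_double
    by (simp only: algebra_simps)
qed

text \<open>Two distinct occurrences lie in the same child or in different children; the latter
  gives the doubled cross term. None involves the root, since \<open>s\<close> cannot occur properly
  inside itself (\<open>occ_eq_0\<close>). The two factors of the cross term and the linear solution
  each contribute an exponent -1/2.\<close>

lemma tree_gf_occ_pairs:
  assumes s: "s \<in> trees m k" and k: "k > 0"
  shows "tree_gf m (\<lambda>t. real (occ s t) * (real (occ s t) - 1))
    = fps_const (2 * real m) * (fps_X ^ (2 * k + 1) * lin_pow (real m) (- (3/2)))"
proof -
  define D where "D = (\<lambda>t. real (occ s t) * (real (occ s t) - 1))"
  let ?Q = "tree_gf m (\<lambda>t. real (occ s t))"
  have "s \<noteq> Leaf" using s k by (auto simp: trees_def)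
  then have "D t = 2 * case_tree 0 (\<lambda>l a r. real (occ s l) * real (occ s r)) t
     + (case_tree 0 (\<lambda>l a r. D l * 1) t + case_tree 0 (\<lambda>l a r. 1 * D r) t)" for t
    by (cases t) (auto simp: D_def occ_eq_0 algebra_simps)
  then have "tree_gf m D = tree_gf m (\<lambda>t. 2 * case_tree 0 (\<lambda>l a r. real (occ s l) * real (occ s r)) t
     + (case_tree 0 (\<lambda>l a r. D l * 1) t + case_tree 0 (\<lambda>l a r. 1 * D r) t))"
    by (intro arg_cong[of _ _ "tree_gf m"] ext)
  then have "tree_gf m D = fps_const 2 * (fps_const (real m) * fps_X * ?Q * ?Q)
     + fps_const (2 * real m) * fps_X * tree_gf m (\<lambda>_. 1) * tree_gf m D"
    unfolding tree_gf_add tree_gf_cmult tree_gf_node fps_const_double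
    by (simp only: algebra_simps)
  then have "tree_gf m D = fps_const 2 * (fps_const (real m) * fps_X * ?Q * ?Q) * lin_pow (real m) (- (1/2))"
    by (rule tree_gf_linear_solve)
  also have "\<dots> = fps_const (2 * real m) * (fps_X ^ (2 * k + 1)
      * (lin_pow (real m) (- (1/2)) * lin_pow (real m) (- (1/2)) * lin_pow (real m) (- (1/2))))"
    unfolding tree_gf_occ[OF s k]
    by (simp add: power_add power_mult power2_eq_square power_mult_distrib mult_ac flip: fps_const_mult)
  also have "lin_pow (real m) (- (1/2)) * lin_pow (real m) (- (1/2)) * lin_pow (real m) (- (1/2)) = lin_pow (real m) (- (3/2))"
    by (simp add: lin_pow_mult)
  finally show ?thesis by (simp add: D_def)
qed

lemma sum_occ:
  assumes "s \<in> trees m k" "k > 0" "k \<le> N"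
  shows "(\<Sum>t\<in>trees m N. real (occ s t)) = (4 * real m) ^ (N - k) * cbin (N - k)"
  using arg_cong[OF tree_gf_occ[OF assms(1,2)], of "\<lambda>F. F $ N"] assms(3)
  by (simp add: tree_gf_nth fps_X_power_mult_nth lin_pow_minus_half_nth)

lemma sum_occ_pairs_le:
  assumes m: "m \<ge> 1" and s: "s \<in> trees m k" and k: "k > 0"
  shows "(\<Sum>t\<in>trees m N. real (occ s t) * (real (occ s t) - 1))
     \<le> num_trees m N * (real N + 1)\<^sup>2 / (4 * real m) ^ (2 * k)"
proof (cases "N < 2 * k + 1")
  \<comment> \<open>Two disjoint copies of \<open>s\<close> and a common ancestor need
    \<open>2 * k + 1\<close> nodes, so the coefficient vanishes.\<close>
  case True
  then show ?thesis
    using arg_cong[OF tree_gf_occ_pairs[OF s k], of "\<lambda>F. F $ N"]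
    by (simp add: tree_gf_nth fps_X_power_mult_nth del: power_Suc)
next
  case False
  define j where "j = N - (2 * k + 1)"
  have N: "N = j + (2 * k + 1)" using False by (simp add: j_def)
  have "(\<Sum>t\<in>trees m N. real (occ s t) * (real (occ s t) - 1))
      = 2 * real m * ((4 * real m) ^ j * ((2 * real j + 1) * cbin j))"
    using arg_cong[OF tree_gf_occ_pairs[OF s k], of "\<lambda>F. F $ N"] False
    by (simp add: tree_gf_nth fps_X_power_mult_nth lin_pow_minus_three_halves_nth j_def
          del: power_Suc)
  also have "\<dots> \<le> 2 * real m * ((4 * real m) ^ j * ((2 * real N + 1) * cbin N))"
    using odd_mult_cbin_mono[of j N] by (intro mult_left_mono) (auto simp: N)
  \<comment> \<open>Rounding up to \<open>2 * N + 2\<close> makes the bound an exact multiple of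
    \<open>num_trees m N\<close>.\<close>
  also have "\<dots> \<le> 2 * real m * ((4 * real m) ^ j * ((2 * real N + 2) * cbin N))"
    using cbin_pos[of N] by (intro mult_left_mono mult_right_mono) auto
  also have "\<dots> = num_trees m N * (real N + 1)\<^sup>2 / (4 * real m) ^ (2 * k)"
  proof -
    have "(4 * real m) ^ N = (4 * real m) ^ j * (4 * real m) ^ (2 * k) * (4 * real m)"
      by (simp add: N power_add)
    then show ?thesis
      using m by (simp add: num_trees_eq power2_eq_square divide_simps)
  qed
  finally show ?thesis .
qed

section \<open>Edges below the roots of fringe subtrees\<close>

definition root_sum :: "nat \<Rightarrow> nat \<Rightarrow> real" where
  "root_sum m k = (\<Sum>s\<in>trees m k. real (root_children s))"

lemma root_sum_nonneg: "root_sum m k \<ge> 0"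
  by (simp add: root_sum_def sum_nonneg)

lemma root_sum_0 [simp]: "root_sum m 0 = 0"
  by (simp add: root_sum_def)

lemma root_sum_le: "root_sum m k \<le> 2 * num_trees m k"
proof -
  have "real (root_children s) \<le> 2" for s :: "nat tree"
    by (cases s) auto
  then have "root_sum m k \<le> (\<Sum>s\<in>trees m k. 2)"
    unfolding root_sum_def by (intro sum_mono)
  then show ?thesis by simp
qed

text \<open>Missing children are easier to count: each node has two slots, and an empty slot leaves
  a free choice only for the other child.\<close>

lemma tree_gf_root_children:
  "tree_gf m (\<lambda>t. real (root_children t)) = 2 * tree_gf m (\<lambda>_. 1) - 3 + lin_pow (real m) (1/2)"
proof -
  \<comment> \<open>The summand for \<open>t = Leaf\<close> makes the total equal to 2 there as
    well.\<close>
  have "real (root_children t) + (2 * of_bool (t = Leaf)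
     + (case_tree 0 (\<lambda>l a r. of_bool (l = Leaf) * 1) t + case_tree 0 (\<lambda>l a r. 1 * of_bool (r = Leaf)) t))
     = 2 * 1" for t :: "nat tree"
    by (cases t) auto
  then have "tree_gf m (\<lambda>t. real (root_children t) + (2 * of_bool (t = Leaf)
     + (case_tree 0 (\<lambda>l a r. of_bool (l = Leaf) * 1) t + case_tree 0 (\<lambda>l a r. 1 * of_bool (r = Leaf)) t)))
     = tree_gf m (\<lambda>_. 2 * 1)"
    by (intro arg_cong[of _ _ "tree_gf m"] ext)
  then show ?thesis
    unfolding tree_gf_add tree_gf_cmult tree_gf_node tree_gf_leaf tree_gf_1[symmetric] fps_const_double
    by (simp add: algebra_simps del: fps_const_add flip: numeral_fps_const)
qed

lemma root_sum_Suc: "root_sum m (Suc j) = 2 * num_trees m (Suc j) - 2 * real m * num_trees m j"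
proof -
  have "root_sum m (Suc j) = tree_gf m (\<lambda>t. real (root_children t)) $ Suc j"
    by (simp add: tree_gf_nth root_sum_def)
  then show ?thesis
    unfolding tree_gf_root_children tree_gf_1[symmetric]
    by (simp add: fps_numeral_fps_const tree_gf_nth mult.assoc)
qed

text \<open>Writes \<open>num_trees m k / (4 m) ^ k\<close> as a difference, so that its partial
  sums collapse.\<close>

lemma cbin_telescope: "cbin k / (real k + 1) = 2 * (cbin k - cbin (Suc k))"
  by (simp add: cbin_Suc field_simps)

text \<open>Both terms of \<open>root_sum_Suc\<close> telescope after scaling. The defect from 1 is
  \<open>4 * cbin (Suc K) - cbin K\<close>, roughly \<open>3 * cbin K\<close>: the source of the
  leading constant 3.\<close>

lemma sum_root_sum_scaled:
  assumes m: "m \<ge> 1"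
  shows "(\<Sum>k=1..K. root_sum m k / (4 * real m) ^ k) = 1 - 4 * cbin (Suc K) + cbin K"
proof -
  have *: "root_sum m (Suc j) / (4 * real m) ^ Suc j
      = 4 * (cbin (Suc j) - cbin (Suc (Suc j))) - (cbin j - cbin (Suc j))" for j
  proof -
    have "2 * num_trees m (Suc j) / (4 * real m) ^ Suc j = 2 * (cbin (Suc j) / (real (Suc j) + 1))"
      using m by (simp add: num_trees_eq divide_simps)
    moreover have "2 * real m * num_trees m j / (4 * real m) ^ Suc j = (cbin j / (real j + 1)) / 2"
      using m by (simp add: num_trees_eq divide_simps)
    ultimately have "root_sum m (Suc j) / (4 * real m) ^ Suc j
        = 2 * (cbin (Suc j) / (real (Suc j) + 1)) - (cbin j / (real j + 1)) / 2"
      unfolding root_sum_Suc diff_divide_distrib by (simp only:)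
    moreover have "(cbin j / (real j + 1)) / 2 = cbin j - cbin (Suc j)"
      unfolding cbin_telescope by simp
    ultimately show ?thesis unfolding cbin_telescope[of "Suc j"] by simp
  qed
  show ?thesis
  proof (induction K)
    case (Suc K)
    then show ?case using *[of K] by (simp del: power_Suc)
  qed (simp add: cbin_Suc)
qed

text \<open>Every node except the root is a child, so a tree with \<open>N\<close> nodes has \<open>N - 1\<close> edges.\<close>

lemma sum_root_sum_conv:
  assumes m: "m \<ge> 1"
  shows "(\<Sum>k=1..N. root_sum m k * ((4 * real m) ^ (N - k) * cbin (N - k)))
     = (real N - 1) * num_trees m N + of_bool (N = 0)"
proof -
  define A where "A = tree_gf m (\<lambda>_. 1)"
  define B where "B = lin_pow (real m) (- (1/2))"
  \<comment> \<open>Multiplying \<open>tree_gf_1\<close> by the inverse square root expresses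
    \<open>A * B\<close> through \<open>B\<close> alone, so its coefficients are explicit.\<close>
  have AB: "B - fps_const (2 * real m) * (fps_X * (A * B)) = 1"
    using arg_cong[OF tree_gf_1[of m], of "\<lambda>F. F * B"]
    by (simp add: A_def B_def lin_pow_mult lin_pow_0 algebra_simps)
  have "2 * real m * (A * B) $ N = B $ Suc N"
    using arg_cong[OF AB, of "\<lambda>F. F $ Suc N"] by simp
  then have AB_N: "(A * B) $ N = B $ Suc N / (2 * real m)"
    using m by (simp add: field_simps)
  have "(\<Sum>k=1..N. root_sum m k * ((4 * real m) ^ (N - k) * cbin (N - k)))
      = (\<Sum>k=0..N. root_sum m k * ((4 * real m) ^ (N - k) * cbin (N - k)))"
    by (simp add: sum.atLeast_Suc_atMost)
  also have "\<dots> = (tree_gf m (\<lambda>t. real (root_children t)) * B) $ N"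
    by (simp add: fps_mult_nth tree_gf_nth root_sum_def B_def lin_pow_minus_half_nth)
  \<comment> \<open>The square root cancels against \<open>B\<close>; the remaining series 1 is
    visible only at \<open>N = 0\<close>.\<close>
  also have "tree_gf m (\<lambda>t. real (root_children t)) * B = 2 * (A * B) - 3 * B + 1"
    by (simp add: tree_gf_root_children A_def B_def lin_pow_mult lin_pow_0 algebra_simps)
  also have "\<dots> $ N = B $ Suc N / real m - 3 * B $ N + of_bool (N = 0)"
    using AB_N by (simp add: fps_numeral_fps_const)
  also have "\<dots> = (real N - 1) * num_trees m N + of_bool (N = 0)"
  proof -
    have "4 * cbin (Suc N) - 3 * cbin N = (real N - 1) * (cbin N / (real N + 1))"
      by (simp add: cbin_Suc field_simps)
    moreover have "B $ Suc N / real m - 3 * B $ N = (4 * real m) ^ N * (4 * cbin (Suc N) - 3 * cbin N)"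
      using m by (simp add: B_def lin_pow_minus_half_nth algebra_simps)
    ultimately show ?thesis
      by (simp add: num_trees_eq[OF m])
  qed
  finally show ?thesis .
qed

section \<open>Counting dag edges by distinct subtrees\<close>

lemma set_tree_subtrees: "s \<in> subtrees t \<Longrightarrow> set_tree s \<subseteq> set_tree t"
  by (induction t) auto

lemma finite_subtrees: "finite (subtrees t)"
  by (induction t) auto

definition num_containing :: "nat \<Rightarrow> nat \<Rightarrow> nat tree \<Rightarrow> real" where
  "num_containing m N s = (\<Sum>t\<in>trees m N. of_bool (s \<in> subtrees t))"

text \<open>Each \<open>s\<close> is charged once for every tree containing it. The union
  \<open>?U\<close> is an index set common to all \<open>t\<close>, which allows the exchange of the
  two sums.\<close>

lemma sum_dag_edges:
  "real (\<Sum>t\<in>trees m N. dag_edges t)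
     = (\<Sum>k=1..N. \<Sum>s\<in>trees m k. real (root_children s) * num_containing m N s)"
proof -
  let ?U = "\<Union>k\<in>{1..N}. trees m k"
  have "real (dag_edges t) = (\<Sum>s\<in>?U. real (root_children s) * of_bool (s \<in> subtrees t))"
    if t: "t \<in> trees m N" for t
  proof -
    have "subtrees t - {Leaf} \<subseteq> ?U"
    proof
      fix s assume s: "s \<in> subtrees t - {Leaf}"
      then have "size s \<in> {1..N}" using size_subtrees[of s t] t
        by (cases s) (auto simp: trees_def)
      moreover have "s \<in> trees m (size s)"
        using s t set_tree_subtrees[of s t] by (auto simp: trees_def)
      ultimately show "s \<in> ?U" by blast
    qed
    moreover have "root_children s = 0" if "s \<in> ?U - (subtrees t - {Leaf})" "s \<in> subtrees t" for s :: "nat tree"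
      using that by auto
    ultimately show ?thesis
      unfolding dag_edges_def of_nat_sum
      by (intro sum.mono_neutral_cong_left) (auto simp: finite_subtrees)
  qed
  then have "real (\<Sum>t\<in>trees m N. dag_edges t)
      = (\<Sum>t\<in>trees m N. \<Sum>s\<in>?U. real (root_children s) * of_bool (s \<in> subtrees t))"
    by simp
  also have "\<dots> = (\<Sum>s\<in>?U. real (root_children s) * num_containing m N s)"
    unfolding num_containing_def sum_distrib_left by (rule sum.swap)
  also have "\<dots> = (\<Sum>k=1..N. \<Sum>s\<in>trees m k. real (root_children s) * num_containing m N s)"
    by (rule sum.UNION_disjoint) (simp, simp, auto simp: trees_def)
  finally show ?thesis .
qed

lemma num_containing_le_num_trees: "num_containing m N s \<le> num_trees m N"
  unfolding num_containing_def by (rule order_trans[OF sum_mono[of _ _ "\<lambda>_. 1"]]) auto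

lemma num_containing_nonneg: "num_containing m N s \<ge> 0"
  unfolding num_containing_def by (rule sum_nonneg) auto

lemma num_containing_le_occ: "num_containing m N s \<le> (\<Sum>t\<in>trees m N. real (occ s t))"
  unfolding num_containing_def
proof (rule sum_mono)
  fix t show "of_bool (s \<in> subtrees t) \<le> real (occ s t)"
    using occ_pos_iff[of s t] by (cases "s \<in> subtrees t") auto
qed

text \<open>Bonferroni: \<open>X - X (X - 1) / 2 \<le> 1\<close> for every natural number \<open>X\<close>.\<close>

lemma num_containing_ge_occ_pairs:
  "num_containing m N s \<ge> (\<Sum>t\<in>trees m N. real (occ s t))
      - (\<Sum>t\<in>trees m N. real (occ s t) * (real (occ s t) - 1)) / 2"
proof -
  have "real (occ s t) - real (occ s t) * (real (occ s t) - 1) / 2 \<le> of_bool (s \<in> subtrees t)" for t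
  proof (cases "occ s t")
    case (Suc x)
    have "0 \<le> real x * (real x - 1)" by (cases x) auto
    then show ?thesis
      using Suc occ_pos_iff[of s t] by (simp add: field_simps)
  qed auto
  then have "(\<Sum>t\<in>trees m N. real (occ s t) - real (occ s t) * (real (occ s t) - 1) / 2)
      \<le> num_containing m N s"
    unfolding num_containing_def by (intro sum_mono)
  then show ?thesis
    by (simp add: sum_subtractf sum_divide_distrib)
qed

section \<open>Bounds for the average number of edges\<close>

lemma avg_dag_edges_eq:
  "avg_dag_edges m n
     = (\<Sum>k=1..Suc n. \<Sum>s\<in>trees m k. real (root_children s) * num_containing m (Suc n) s)
       / num_trees m (Suc n)"
  by (simp only: avg_dag_edges_def labeled_trees_eq sum_dag_edges)

lemma num_trees_pos: "m \<ge> 1 \<Longrightarrow> num_trees m n > 0"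
  using cbin_pos[of n] by (simp add: num_trees_eq)

text \<open>The expected number of children among the roots of the fringe subtrees with more than \<open>K\<close>
  nodes, counted with multiplicity.\<close>

definition tail_edges :: "nat \<Rightarrow> nat \<Rightarrow> nat \<Rightarrow> real" where
  "tail_edges m K N =
     (\<Sum>k=Suc K..N. root_sum m k * ((4 * real m) ^ (N - k) * cbin (N - k))) / num_trees m N"

lemma tail_edges_mult:
  assumes "m \<ge> 1"
  shows "tail_edges m K N * num_trees m N
    = (\<Sum>k=Suc K..N. root_sum m k * ((4 * real m) ^ (N - k) * cbin (N - k)))"
proof -
  have nz: "num_trees m N \<noteq> 0" using num_trees_pos[OF assms, of N] by linarith
  show ?thesis
    unfolding tail_edges_def by (simp only: times_divide_eq_left nonzero_mult_div_cancel_right[OF nz])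
qed

lemma sum_split_at:
  fixes f :: "nat \<Rightarrow> real"
  assumes "K \<le> N"
  shows "(\<Sum>k=1..N. f k) = (\<Sum>k=1..K. f k) + (\<Sum>k=Suc K..N. f k)"
  using sum.ub_add_nat[of 1 K f "N - K"] assms by simp

text \<open>A subtree with at most \<open>K\<close> nodes is assumed to occur in every tree; for
  larger ones each occurrence is counted as if it were new.\<close>

lemma avg_dag_edges_upper:
  assumes m: "m \<ge> 1" and K: "K \<le> n"
  shows "avg_dag_edges m n \<le> tail_edges m K (Suc n) + (\<Sum>k=1..K. root_sum m k)"
proof -
  let ?N = "Suc n"
  let ?f = "\<lambda>k. \<Sum>s\<in>trees m k. real (root_children s) * num_containing m ?N s"
  have small: "?f k \<le> root_sum m k * num_trees m ?N" for k
    unfolding root_sum_def sum_distrib_right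
    by (intro sum_mono mult_left_mono num_containing_le_num_trees) auto
  have large: "?f k \<le> root_sum m k * ((4 * real m) ^ (?N - k) * cbin (?N - k))"
    if "k \<in> {Suc K..?N}" for k
    unfolding root_sum_def sum_distrib_right
  proof (rule sum_mono)
    fix s assume "s \<in> trees m k"
    then have "num_containing m ?N s \<le> (4 * real m) ^ (?N - k) * cbin (?N - k)"
      using that num_containing_le_occ[of m ?N s] sum_occ[of s m k ?N] by simp
    then show "real (root_children s) * num_containing m ?N s
        \<le> real (root_children s) * ((4 * real m) ^ (?N - k) * cbin (?N - k))"
      by (intro mult_left_mono) auto
  qed
  have "(\<Sum>k=1..?N. ?f k) = (\<Sum>k=1..K. ?f k) + (\<Sum>k=Suc K..?N. ?f k)"
    using K by (intro sum_split_at) simp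
  also have "\<dots> \<le> (\<Sum>k=1..K. root_sum m k * num_trees m ?N)
      + (\<Sum>k=Suc K..?N. root_sum m k * ((4 * real m) ^ (?N - k) * cbin (?N - k)))"
    by (intro add_mono sum_mono small large)
  also have "\<dots> = (tail_edges m K ?N + (\<Sum>k=1..K. root_sum m k)) * num_trees m ?N"
    unfolding tail_edges_mult[OF m, symmetric]
    by (simp only: distrib_right sum_distrib_right add.commute)
  finally show ?thesis
    unfolding avg_dag_edges_eq using num_trees_pos[OF m, of ?N] by (simp add: pos_divide_le_eq del: sum.cl_ivl_Suc)
qed

lemma sum_inverse_powers_le:
  fixes x :: real
  assumes "x \<ge> 2"
  shows "(\<Sum>k=Suc K..N. 1 / x ^ k) \<le> 1 / x ^ K"
proof (cases "K \<le> N")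
  case True
  \<comment> \<open>The subtracted last term strengthens the claim enough for induction.\<close>
  have "(\<Sum>k=Suc K..K + d. 1 / x ^ k) \<le> 1 / x ^ K - 1 / x ^ (K + d)" for d
  proof (induction d)
    case (Suc d)
    have "2 * (1 / x ^ Suc (K + d)) \<le> 1 / x ^ (K + d)"
      using assms by (simp add: field_simps)
    with Suc show ?case by simp
  qed simp
  from this[of "N - K"] True assms show ?thesis
    by (smt (verit) le_add_diff_inverse zero_le_divide_1_iff zero_le_power)
qed (use assms in simp)

text \<open>Small subtrees are dropped, and the Bonferroni bound is applied to the others. With
  \<open>root_sum_le\<close> the pair corrections become a geometric series dominated by its start
  near \<open>K\<close>.\<close>

lemma avg_dag_edges_lower:
  assumes m: "m \<ge> 1" and K: "K \<le> n"
  shows "avg_dag_edges m n \<ge> tail_edges m K (Suc n)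
     - (real n + 2)\<^sup>2 * (cbin K / (real K + 1)) / (4 * real m) ^ K"
proof -
  let ?N = "Suc n"
  let ?f = "\<lambda>k. \<Sum>s\<in>trees m k. real (root_children s) * num_containing m ?N s"
  let ?A = "num_trees m ?N"
  let ?D = "\<lambda>k. ?A * (real ?N + 1)\<^sup>2 / (4 * real m) ^ (2 * k) / 2"
  have small: "0 \<le> ?f k" for k
    by (intro sum_nonneg mult_nonneg_nonneg num_containing_nonneg) auto
  have large: "root_sum m k * ((4 * real m) ^ (?N - k) * cbin (?N - k))
      - ?A * ((real ?N + 1)\<^sup>2 * (cbin K / (real K + 1)) * (1 / (4 * real m) ^ k)) \<le> ?f k"
    if k: "k \<in> {Suc K..?N}" for k
  proof -
    have "root_sum m k * ?D k \<le> 2 * num_trees m k * ?D k"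
      by (intro mult_right_mono root_sum_le) auto
    also have "\<dots> = ?A * ((real ?N + 1)\<^sup>2 * (cbin k / (real k + 1)) * (1 / (4 * real m) ^ k))"
    proof -
      define p where "p = (4 * real m) ^ k"
      define c where "c = (real ?N + 1)\<^sup>2"
      have p: "num_trees m k = p * cbin k / (real k + 1)" "(4 * real m) ^ (2 * k) = p * p" "p \<noteq> 0"
        using m by (simp_all add: p_def num_trees_eq[OF m] mult_2 power_add)
      show ?thesis
        unfolding p(1,2) p_def[symmetric] c_def[symmetric] using p(3) by simp
    qed
    \<comment> \<open>Monotonicity replaces \<open>k\<close> by \<open>K\<close> in all but the
      geometric factor.\<close>
    also have "\<dots> \<le> ?A * ((real ?N + 1)\<^sup>2 * (cbin K / (real K + 1)) * (1 / (4 * real m) ^ k))"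
      using k decseqD[OF decseq_cbin, of K k] cbin_pos[of k]
      by (intro mult_left_mono mult_right_mono frac_le) auto
    finally have "root_sum m k * ((4 * real m) ^ (?N - k) * cbin (?N - k))
        - ?A * ((real ?N + 1)\<^sup>2 * (cbin K / (real K + 1)) * (1 / (4 * real m) ^ k))
        \<le> root_sum m k * ((4 * real m) ^ (?N - k) * cbin (?N - k) - ?D k)"
      by (simp add: algebra_simps)
    also have "\<dots> \<le> ?f k"
      unfolding root_sum_def sum_distrib_right
    proof (rule sum_mono)
      fix s assume s: "s \<in> trees m k"
      have "(4 * real m) ^ (?N - k) * cbin (?N - k) - ?D k \<le> num_containing m ?N s"
        using num_containing_ge_occ_pairs[of s m ?N] sum_occ[OF s, of ?N]
          sum_occ_pairs_le[OF m s, of ?N] k by (simp del: of_nat_Suc power_Suc)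
      then show "real (root_children s) * ((4 * real m) ^ (?N - k) * cbin (?N - k) - ?D k)
          \<le> real (root_children s) * num_containing m ?N s"
        by (intro mult_left_mono) auto
    qed
    finally show ?thesis .
  qed
  have "?A * (tail_edges m K ?N - (real ?N + 1)\<^sup>2 * (cbin K / (real K + 1)) * (1 / (4 * real m) ^ K))
      \<le> ?A * (tail_edges m K ?N
          - (real ?N + 1)\<^sup>2 * (cbin K / (real K + 1)) * (\<Sum>k=Suc K..?N. 1 / (4 * real m) ^ k))"
    using m cbin_pos[of K]
    by (intro mult_left_mono diff_left_mono sum_inverse_powers_le) auto
  also have "\<dots> = (\<Sum>k=Suc K..?N. root_sum m k * ((4 * real m) ^ (?N - k) * cbin (?N - k))
      - ?A * ((real ?N + 1)\<^sup>2 * (cbin K / (real K + 1)) * (1 / (4 * real m) ^ k)))"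
    unfolding sum_subtractf sum_distrib_left[symmetric] right_diff_distrib tail_edges_mult[OF m, symmetric]
    by (simp only: mult.commute)
  also have "\<dots> \<le> (\<Sum>k=Suc K..?N. ?f k)"
    by (intro sum_mono large)
  also have "\<dots> \<le> (\<Sum>k=1..?N. ?f k)"
  proof -
    have "(\<Sum>k=1..?N. ?f k) = (\<Sum>k=1..K. ?f k) + (\<Sum>k=Suc K..?N. ?f k)"
      using K by (intro sum_split_at) simp
    moreover have "0 \<le> (\<Sum>k=1..K. ?f k)" by (intro sum_nonneg small)
    ultimately show ?thesis by simp
  qed
  finally have "tail_edges m K ?N - (real ?N + 1)\<^sup>2 * (cbin K / (real K + 1)) * (1 / (4 * real m) ^ K)
      \<le> avg_dag_edges m n"
    unfolding avg_dag_edges_eq using num_trees_pos[OF m, of ?N]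
    by (simp add: pos_le_divide_eq mult.commute del: sum.cl_ivl_Suc of_nat_Suc)
  then show ?thesis by (simp add: add.commute)
qed

text \<open>From size 1 on the number of trees at least doubles with each node, so the last term
  dominates.\<close>

lemma sum_num_trees_le:
  assumes m: "m \<ge> 1" and K: "K \<ge> 1"
  shows "(\<Sum>k=1..K. num_trees m k) \<le> 2 * num_trees m K"
  using K
proof (induction K rule: dec_induct)
  case (step k)
  have "2 * (cbin k / (real k + 1)) \<le> 4 * (cbin (Suc k) / (real (Suc k) + 1))"
  proof -
    \<comment> \<open>Here \<open>k \<ge> 1\<close> is used, in the form that \<open>k + 2\<close>
      is at most \<open>2 * k + 1\<close>.\<close>
    have "cbin k * (2 * (real k + 2)) \<le> cbin k * (2 * (2 * real k + 1))"
      using step cbin_pos[of k] by (intro mult_left_mono) auto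
    then have "cbin k * (2 * (real k + 2)) / ((real k + 1) * (real k + 2))
        \<le> cbin k * (2 * (2 * real k + 1)) / ((real k + 1) * (real k + 2))"
      by (intro divide_right_mono) auto
    also have "\<dots> = 4 * (cbin (Suc k) / (real (Suc k) + 1))"
      by (simp add: cbin_Suc divide_simps) (simp add: algebra_simps)
    finally show ?thesis
      using mult_divide_mult_cancel_right[of "real k + 2" "2 * cbin k" "real k + 1"] by (simp add: mult_ac)
  qed
  then have "2 * (cbin k / (real k + 1)) \<le> 4 * real m * (cbin (Suc k) / (real (Suc k) + 1))"
    using m cbin_pos[of "Suc k"]
      mult_right_mono[of 4 "4 * real m" "cbin (Suc k) / (real (Suc k) + 1)"] by simp
  then have "(4 * real m) ^ k * (2 * (cbin k / (real k + 1)))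
      \<le> (4 * real m) ^ k * (4 * real m * (cbin (Suc k) / (real (Suc k) + 1)))"
    by (intro mult_left_mono) auto
  then have "2 * num_trees m k \<le> num_trees m (Suc k)"
    by (simp add: num_trees_eq[OF m] mult_ac)
  with step show ?case by simp
qed simp

text \<open>Passes to the complement, all edges minus those below small subtrees: for
  \<open>k \<le> K\<close> the ratio \<open>cbin (N - k) / cbin N\<close> is close to 1.\<close>

lemma tail_edges_eq:
  assumes m: "m \<ge> 1" and K: "K \<le> N" and N: "N > 0"
  shows "tail_edges m K N = real N - 1
     - (real N + 1) * (\<Sum>k=1..K. root_sum m k / (4 * real m) ^ k * (cbin (N - k) / cbin N))"
proof -
  let ?g = "\<lambda>k. root_sum m k * ((4 * real m) ^ (N - k) * cbin (N - k))"
  let ?A = "num_trees m N"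
  have nz: "?A \<noteq> 0" using num_trees_pos[OF m, of N] by linarith
  have "tail_edges m K N = ((real N - 1) * ?A - (\<Sum>k=1..K. ?g k)) / ?A"
    using sum_split_at[OF K, of ?g] sum_root_sum_conv[OF m, of N] N
    unfolding tail_edges_def by (simp del: sum.cl_ivl_Suc)
  also have "\<dots> = real N - 1 - (\<Sum>k=1..K. ?g k / ?A)"
    unfolding diff_divide_distrib sum_divide_distrib[symmetric] nonzero_mult_div_cancel_right[OF nz] ..
  also have "(\<Sum>k=1..K. ?g k / ?A)
      = (\<Sum>k=1..K. (real N + 1) * (root_sum m k / (4 * real m) ^ k * (cbin (N - k) / cbin N)))"
  proof (intro sum.cong refl)
    fix k assume "k \<in> {1..K}"
    then have "(4 * real m) ^ N = (4 * real m) ^ (N - k) * (4 * real m) ^ k"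
      using K by (metis atLeastAtMost_iff le_add_diff_inverse2 le_trans power_add)
    then show "?g k / ?A = (real N + 1) * (root_sum m k / (4 * real m) ^ k * (cbin (N - k) / cbin N))"
      using m cbin_pos[of N] by (simp add: num_trees_eq[OF m] divide_simps)
  qed
  finally show ?thesis by (simp add: sum_distrib_left)
qed

text \<open>In \<open>tail_edges_eq\<close> the ratios lie between 1 and \<open>N / (N - K)\<close>,
  so the sum is \<open>Q\<close> up to a relative error of order \<open>K / N\<close>.\<close>

lemma tail_edges_bounds:
  assumes m: "m \<ge> 1" and K: "2 * K \<le> N" and N: "N > 0"
  shows "tail_edges m K N \<le> 3 * (real N + 1) * cbin K"
    and "tail_edges m K N
           \<ge> 3 * (real N + 1) * cbin K - 2 * (real N + 1) * (cbin K / (real K + 1)) - 2 - 4 * real K"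
proof -
  let ?q = "\<lambda>k. root_sum m k / (4 * real m) ^ k"
  define Q where "Q = 1 - 4 * cbin (Suc K) + cbin K"
  have Q: "(\<Sum>k=1..K. ?q k) = Q"
    unfolding Q_def by (rule sum_root_sum_scaled[OF m])
  have q0: "?q k \<ge> 0" for k
    by (simp add: root_sum_nonneg)
  have Q_eq: "1 - Q = 3 * cbin K - 2 * (cbin K / (real K + 1))"
    by (simp add: Q_def cbin_Suc field_simps)
  have Q1: "Q \<le> 1"
  proof -
    have "2 * (cbin K / (real K + 1)) \<le> 2 * cbin K"
      using cbin_pos[of K] by (simp add: divide_le_eq)
    then show ?thesis using Q_eq cbin_pos[of K] by simp
  qed
  let ?S = "\<Sum>k=1..K. ?q k * (cbin (N - k) / cbin N)"
  have T: "tail_edges m K N = real N - 1 - (real N + 1) * ?S"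
    using K N by (intro tail_edges_eq[OF m]) auto
  have "Q \<le> ?S"
    unfolding Q[symmetric]
  proof (rule sum_mono)
    fix k
    have "1 \<le> cbin (N - k) / cbin N"
      using decseqD[OF decseq_cbin, of "N - k" N] cbin_pos[of N] by (simp add: le_divide_eq)
    from mult_left_mono[OF this q0] show "?q k \<le> ?q k * (cbin (N - k) / cbin N)" by simp
  qed
  then have "(real N + 1) * Q \<le> (real N + 1) * ?S" by (intro mult_left_mono) auto
  then have "tail_edges m K N \<le> real N - 1 - (real N + 1) * Q" using T by simp
  also have "\<dots> \<le> (real N + 1) * (1 - Q)" by (simp add: algebra_simps)
  also have "\<dots> \<le> (real N + 1) * (3 * cbin K)"
    unfolding Q_eq using cbin_pos[of K] by (intro mult_left_mono) auto
  finally show "tail_edges m K N \<le> 3 * (real N + 1) * cbin K" by (simp add: mult_ac)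
  have "?S \<le> (\<Sum>k=1..K. ?q k * (real N / (real N - real K)))"
  proof (intro sum_mono mult_left_mono q0)
    fix k assume k: "k \<in> {1..K}"
    have "(real N - real k) * cbin (N - k) \<le> real N * cbin N"
      using mult_cbin_mono[of "N - k" N] k K by (simp add: of_nat_diff)
    then have "cbin (N - k) / cbin N \<le> real N / (real N - real k)"
      using cbin_pos[of N] k K N by (simp add: field_simps)
    also have "\<dots> \<le> real N / (real N - real K)"
      using k K N by (intro divide_left_mono mult_pos_pos) auto
    finally show "cbin (N - k) / cbin N \<le> real N / (real N - real K)" .
  qed
  also have "\<dots> = Q * (real N / (real N - real K))"
    unfolding sum_distrib_right[symmetric] Q ..
  also have "\<dots> = Q + Q * (real K / (real N - real K))"
    using K N by (simp add: field_simps)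
  also have "\<dots> \<le> Q + 1 * (real K / (real N - real K))"
    using Q1 K N by (intro add_left_mono mult_right_mono) auto
  also have "\<dots> \<le> Q + 4 * real K / (real N + 1)"
  proof -
    \<comment> \<open>From \<open>2 * K \<le> N\<close> and \<open>N \<ge> 1\<close> one gets
      \<open>N + 1 \<le> 2 * N \<le> 4 * (N - K)\<close>.\<close>
    have "real K * (real N + 1) \<le> real K * (4 * (real N - real K))"
      using K N by (intro mult_left_mono) auto
    then show ?thesis using K N by (simp add: field_simps)
  qed
  finally have "(real N + 1) * ?S \<le> (real N + 1) * (Q + 4 * real K / (real N + 1))"
    by (intro mult_left_mono) auto
  also have "\<dots> = (real N + 1) * Q + 4 * real K"
    by (simp add: distrib_left)
  finally have "tail_edges m K N \<ge> (real N + 1) * (1 - Q) - 2 - 4 * real K"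
    using T by (simp add: algebra_simps)
  then show "tail_edges m K N
      \<ge> 3 * (real N + 1) * cbin K - 2 * (real N + 1) * (cbin K / (real K + 1)) - 2 - 4 * real K"
    unfolding Q_eq by (simp only: right_diff_distrib mult.assoc mult.left_commute[of "real N + 1"])
qed

text \<open>The cut balances both errors: \<open>(4 m) ^ K \<le> n\<close> limits the number of
  small trees, and \<open>n < (4 m) ^ Suc K\<close> limits the repetitions of large ones.\<close>

lemma avg_dag_edges_approx:
  assumes m: "m \<ge> 1" and K: "K \<ge> 1" "2 * K \<le> n"
    and le: "(4 * real m) ^ K \<le> real n" and less: "real n < (4 * real m) ^ Suc K"
  shows "\<bar>avg_dag_edges m n - 3 * real n * cbin K\<bar>
    \<le> (6 + 36 * real m) * real n * (cbin K / (real K + 1)) + 6 + 4 * real K"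
proof -
  define z where "z = cbin K / (real K + 1)"
  have z: "z \<ge> 0" using cbin_pos[of K] by (simp add: z_def)
  have n1: "real n \<ge> 2" using K by simp
  have u1: "cbin K \<le> 1" using decseqD[OF decseq_cbin, of 0 K] by simp
  have "(\<Sum>k=1..K. root_sum m k) \<le> (\<Sum>k=1..K. 2 * num_trees m k)"
    by (intro sum_mono root_sum_le)
  also have "\<dots> \<le> 2 * (2 * num_trees m K)"
    unfolding sum_distrib_left[symmetric] using sum_num_trees_le[OF m K(1)] by simp
  also have "\<dots> = 4 * ((4 * real m) ^ K * z)"
    by (simp add: num_trees_eq[OF m] z_def)
  also have "\<dots> \<le> 4 * (real n * z)"
    using le z by (intro mult_left_mono mult_right_mono) auto
  finally have small: "(\<Sum>k=1..K. root_sum m k) \<le> 4 * (real n * z)" .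
  have upper: "avg_dag_edges m n \<le> 3 * (real n + 2) * cbin K + 4 * (real n * z)"
    using avg_dag_edges_upper[OF m, of K n] tail_edges_bounds(1)[OF m, of K "Suc n"] small K
    by (simp add: add.commute)
  have "(real n + 2)\<^sup>2 \<le> (2 * real n)\<^sup>2"
    using n1 by (intro power_mono) auto
  \<comment> \<open>Only one of the two factors \<open>n\<close> is traded for the power, which
    after division by \<open>(4 m) ^ K\<close> costs \<open>4 * m\<close>.\<close>
  also have "\<dots> \<le> 4 * (real n * ((4 * real m) ^ Suc K))"
    using mult_left_mono[of "real n" "(4 * real m) ^ Suc K" "real n"] less
    by (simp add: power2_eq_square del: power_Suc)
  finally have "(real n + 2)\<^sup>2 * z \<le> 4 * (real n * ((4 * real m) ^ Suc K)) * z"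
    using z by (intro mult_right_mono)
  then have pairs: "(real n + 2)\<^sup>2 * z / (4 * real m) ^ K \<le> 16 * real m * (real n * z)"
    using m by (simp add: pos_divide_le_eq mult_ac)
  have "avg_dag_edges m n \<ge> 3 * (real n + 2) * cbin K - 2 * (real n + 2) * z - 2 - 4 * real K
      - 16 * real m * (real n * z)"
    using avg_dag_edges_lower[OF m, of K n] tail_edges_bounds(2)[OF m, of K "Suc n"] pairs K
    unfolding z_def[symmetric] by (simp add: add.commute)
  moreover have "2 * (real n + 2) * z \<le> 6 * (real n * z)"
    using mult_right_mono[of "2 * (real n + 2)" "6 * real n" z] n1 z by simp
  moreover have "0 \<le> real m * (real n * z)" "0 \<le> real n * z" using z by auto
  ultimately show ?thesis
    using upper u1 cbin_pos[of K] unfolding z_def[symmetric] by (simp add: abs_le_iff algebra_simps)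
qed

section \<open>From the integer cut to the logarithm\<close>

lemma inverse_sqrt_diff_le:
  fixes x :: real
  assumes "x > 0"
  shows "1 / sqrt x - 1 / sqrt (x + 1) \<le> 1 / (x * sqrt x)"
proof -
  define a b where "a = sqrt x" and "b = sqrt (x + 1)"
  have a: "a > 0" "a * a = x" and b: "b \<ge> a" "b * b = x + 1"
    using assms by (auto simp: a_def b_def)
  have "(b - a) * a \<le> (b - a) * (b + a)"
    using a b by (intro mult_left_mono) auto
  also have "\<dots> = 1" using a b by (simp add: algebra_simps)
  finally have "b - a \<le> 1 / a" using a by (simp add: pos_le_divide_eq)
  moreover have "1 / (a * b) \<le> 1 / (a * a)"
    using a b by (intro divide_left_mono mult_left_mono mult_pos_pos) auto
  ultimately have "(b - a) * (1 / (a * b)) \<le> 1 / a * (1 / (a * a))"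
    using a b by (intro mult_mono) auto
  moreover have "1 / a - 1 / b = (b - a) * (1 / (a * b))"
    using a b by (simp add: field_simps)
  ultimately show ?thesis
    unfolding a(2)[symmetric] by (simp add: a_def[symmetric] b_def[symmetric] a(2) mult.commute)
qed

text \<open>Both quantities lie between \<open>1 / sqrt (pi * (K + 1))\<close> and
  \<open>1 / sqrt (pi * K)\<close>, and that interval is short.\<close>

lemma cbin_approx:
  assumes K: "K \<ge> 1" and L: "real K \<le> L" "L < real K + 1"
  shows "\<bar>cbin K - 1 / sqrt (pi * L)\<bar> \<le> 1 / (real K * sqrt (real K))"
proof -
  let ?a = "1 / sqrt (pi * real K)" and ?b = "1 / sqrt (pi * (real K + 1))"
  have "?b \<le> 1 / sqrt (pi * (real K + 1 / 2))"
    using K by (intro divide_left_mono mult_pos_pos real_sqrt_le_mono mult_left_mono) auto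
  then have u: "?b \<le> cbin K" "cbin K \<le> ?a"
    using cbin_lower[of K] cbin_upper[of K] K by auto
  have l: "?b \<le> 1 / sqrt (pi * L)" "1 / sqrt (pi * L) \<le> ?a"
    using K L by (intro divide_left_mono mult_pos_pos real_sqrt_le_mono mult_left_mono; simp)+
  have "1 \<le> sqrt pi" using pi_gt3 by simp
  have "?a - ?b = (1 / sqrt (real K) - 1 / sqrt (real K + 1)) / sqrt pi"
    by (simp add: real_sqrt_mult diff_divide_distrib mult.commute)
  also have "\<dots> \<le> (1 / sqrt (real K) - 1 / sqrt (real K + 1)) / 1"
    using \<open>1 \<le> sqrt pi\<close> K by (intro divide_left_mono) (auto simp: frac_le)
  also have "\<dots> \<le> 1 / (real K * sqrt (real K))"
    using inverse_sqrt_diff_le[of "real K"] K by simp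
  finally show ?thesis using u l by linarith
qed

text \<open>Here \<open>L\<close> is the logarithm of \<open>n\<close> to base \<open>4 m\<close>
  and its floor is the cut. The hypothesis \<open>big\<close> absorbs the additive error
  \<open>6 + 4 * K\<close>.\<close>

lemma avg_dag_edges_asymp:
  assumes m: "m \<ge> 1" and L_def: "L = ln (real n) / ln (4 * real m)" and L1: "L \<ge> 1"
    and big: "10 * L * (L * sqrt L) \<le> real n"
  shows "\<bar>avg_dag_edges m n - 3 * real n / sqrt (pi * L)\<bar>
    \<le> (37 + 144 * real m) * (real n / (L * sqrt L))"
proof -
  define K where "K = nat \<lfloor>L\<rfloor>"
  define c where "c = ln (4 * real m)"
  have c: "c > 0" using m by (simp add: c_def)
  have K: "real K \<le> L" "L < real K + 1" "K \<ge> 1"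
    using L1 unfolding K_def by linarith+
  have sL: "sqrt L \<ge> 1" using L1 by simp
  then have LL: "L * sqrt L \<ge> 1" using L1 by (smt (verit) mult_le_cancel_left1)
  then have "10 * L \<le> 10 * L * (L * sqrt L)"
    using L1 by (smt (verit) mult_le_cancel_left1)
  then have n: "10 * L \<le> real n" using big by linarith
  then have n0: "real n > 0" using L1 by linarith
  have pow: "(4 * real m) ^ k = exp (real k * c)" for k
    using m by (simp add: c_def exp_of_nat_mult)
  have nL: "real n = exp (L * c)"
    using n0 c by (simp add: L_def c_def[symmetric])
  have "2 * K \<le> n" using n K by linarith
  moreover have "(4 * real m) ^ K \<le> real n"
    unfolding pow nL using K c by simp
  moreover have "real n < (4 * real m) ^ Suc K"
    unfolding pow nL using K c by (simp add: add.commute)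
  ultimately have main: "\<bar>avg_dag_edges m n - 3 * real n * cbin K\<bar>
      \<le> (6 + 36 * real m) * real n * (cbin K / (real K + 1)) + 6 + 4 * real K"
    using avg_dag_edges_approx[OF m K(3)] by blast
  define y where "y = real n / (L * sqrt L)"
  define w where "w = 1 / (real K * sqrt (real K))"
  have "cbin K / (real K + 1) \<le> w"
  proof -
    have "cbin K \<le> 1 / sqrt (pi * real K)" using cbin_upper[of K] K by simp
    also have "\<dots> \<le> 1 / sqrt (1 * real K)"
      using K pi_gt3 by (intro divide_left_mono real_sqrt_le_mono mult_right_mono mult_pos_pos) auto
    finally have "cbin K / (real K + 1) \<le> (1 / sqrt (real K)) / real K"
      using K cbin_pos[of K] by (intro frac_le) auto
    then show ?thesis by (simp add: w_def mult.commute)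
  qed
  then have "(6 + 36 * real m) * real n * (cbin K / (real K + 1)) \<le> (6 + 36 * real m) * real n * w"
    by (intro mult_left_mono) auto
  moreover have "\<bar>3 * real n * cbin K - 3 * real n / sqrt (pi * L)\<bar> \<le> 3 * real n * w"
  proof -
    have "\<bar>3 * real n * cbin K - 3 * real n / sqrt (pi * L)\<bar> = 3 * real n * \<bar>cbin K - 1 / sqrt (pi * L)\<bar>"
    proof -
      have "3 * real n * cbin K - 3 * real n / sqrt (pi * L) = 3 * real n * (cbin K - 1 / sqrt (pi * L))"
        by (simp add: right_diff_distrib)
      then show ?thesis by (simp add: abs_mult)
    qed
    also have "\<dots> \<le> 3 * real n * w"
      unfolding w_def using K by (intro mult_left_mono cbin_approx) auto
    finally show ?thesis .
  qed
  ultimately have "\<bar>avg_dag_edges m n - 3 * real n / sqrt (pi * L)\<bar>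
      \<le> (9 + 36 * real m) * (real n * w) + (6 + 4 * real K)"
    using main by (simp add: algebra_simps abs_le_iff)
  moreover have "w \<le> 4 / (L * sqrt L)"
  proof -
    \<comment> \<open>Since \<open>K \<ge> 1\<close> and \<open>L < K + 1\<close>, both
      \<open>L / 2\<close> and \<open>L / 4\<close> are at most \<open>K\<close>; the quarter has a
      rational root factor.\<close>
    have "L / 2 * sqrt (L / 4) \<le> real K * sqrt (real K)"
    proof -
      have "real K \<ge> 1" using K(3) by simp
      then show ?thesis
        using K(1,2) by (intro mult_mono real_sqrt_le_mono) auto
    qed
    then have "L * sqrt L / 4 \<le> real K * sqrt (real K)"
      by (simp add: real_sqrt_divide)
    then have "1 / (real K * sqrt (real K)) \<le> 1 / (L * sqrt L / 4)"
      using LL by (intro divide_left_mono mult_pos_pos) (use K in auto)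
    then show ?thesis by (simp add: w_def)
  qed
  then have "real n * w \<le> 4 * y"
    using mult_left_mono[of w "4 / (L * sqrt L)" "real n"] by (simp add: y_def mult.commute)
  then have "(9 + 36 * real m) * (real n * w) \<le> (9 + 36 * real m) * (4 * y)"
    by (intro mult_left_mono) auto
  moreover have "6 + 4 * real K \<le> y"
  proof -
    have "6 + 4 * real K \<le> 10 * L" using K L1 by linarith
    also have "\<dots> \<le> real n / (L * sqrt L)"
      using big LL by (simp add: pos_le_divide_eq)
    finally show ?thesis by (simp add: y_def)
  qed
  ultimately show ?thesis unfolding y_def[symmetric] by (simp add: algebra_simps)
qed

theorem theorem8:
  fixes m :: nat
  assumes "m \<ge> 1"
  shows "(\<lambda>n::nat. avg_dag_edges m n - 3 * kappa m * real n / sqrt (ln (real n)))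
           \<in> O[at_top](\<lambda>n::nat. 3 * kappa m * real n / sqrt (ln (real n)) * (1 / ln (real n)))"
proof -
  define c where "c = ln (4 * real m)"
  \<comment> \<open>The factor \<open>sqrt pi * c / 3\<close> converts
    \<open>n / (L * sqrt L)\<close> into the claimed error scale, using
    \<open>ln n = c * L\<close>.\<close>
  define C where "C = (37 + 144 * real m) * (sqrt pi * c / 3)"
  have c: "c > 0" using assms by (simp add: c_def)
  have "eventually (\<lambda>n::nat. ln (real n) / c \<ge> 1) at_top"
    using c by real_asymp
  moreover have "eventually (\<lambda>n::nat. 10 * (ln (real n) / c) * ((ln (real n) / c) * sqrt (ln (real n) / c))
      \<le> real n) at_top"
    using c by real_asymp
  ultimately have "eventually (\<lambda>n::nat.
      norm (avg_dag_edges m n - 3 * kappa m * real n / sqrt (ln (real n)))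
      \<le> C * norm (3 * kappa m * real n / sqrt (ln (real n)) * (1 / ln (real n)))) at_top"
  proof eventually_elim
    case (elim n)
    define L where "L = ln (real n) / c"
    have L1: "L \<ge> 1" using elim(1) by (simp add: L_def)
    have ln_n: "ln (real n) = c * L" using c by (simp add: L_def)
    \<comment> \<open>The base of the logarithm cancels:
      \<open>sqrt (c / pi) / sqrt (c * L) = 1 / sqrt (pi * L)\<close>.\<close>
    have kappa: "3 * kappa m * real n / sqrt (ln (real n)) = 3 * real n / sqrt (pi * L)"
      unfolding kappa_def ln_n c_def[symmetric] using c L1
      by (simp add: real_sqrt_mult real_sqrt_divide)
    have "\<bar>avg_dag_edges m n - 3 * real n / sqrt (pi * L)\<bar> \<le> (37 + 144 * real m) * (real n / (L * sqrt L))"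
      using elim L1 by (intro avg_dag_edges_asymp[OF assms]) (auto simp: L_def c_def)
    also have "real n / (L * sqrt L) = sqrt pi * c / 3 * (3 * real n / sqrt (pi * L) * (1 / (c * L)))"
      using c L1 by (simp add: real_sqrt_mult field_simps)
    also have "3 * real n / sqrt (pi * L) * (1 / (c * L)) = norm (3 * real n / sqrt (pi * L) * (1 / (c * L)))"
      using c L1 by simp
    finally show ?case
      unfolding kappa unfolding ln_n C_def by (simp only: real_norm_def mult.assoc)
  qed
  then show ?thesis by (rule bigoI)
qed

end
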